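(* Let $\mathcal H=\{P_4, C_4, S_4\}$. Then $\chi'_{\mathcal H}(n)=\frac{3}{4}n+o(n)$ as $n\to\infty$.
   Context: For a graph $G$ and a set $\mathcal H$ of small graphs, an $\mathcal H$-avoiding bipartite partition of $G$ is a collection of bipartite graphs $G_1,\dots,G_k$ (subgraphs of $G$) whose edge sets are pairwise disjoint with union $E(G)$, such that no $G_i$ contains any member of $\mathcal H$ as an induced subgraph. $\chi'_{\mathcal H}(G)$ is the smallest $k$ for which such a partition with $k$ graphs exists, and $\chi'_{\mathcal H}(n):=\chi'_{\mathcal H}(K_n)$, where $K_n$ is the complete graph on $n$ vertices. $P_4$ is the path on 4 vertices, $C_4$ the cycle on 4 vertices, and $S_4$ the star on 4 vertices ($K_{1,3}$). *)

theory Defs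
  imports Complex_Main "HOL-Library.Landau_Symbols"
begin

type_synonym 'a ugraph = "'a set \<times> 'a set set"

abbreviation vset :: "'a ugraph \<Rightarrow> 'a set" where "vset G \<equiv> fst G"

abbreviation eset :: "'a ugraph \<Rightarrow> 'a set set" where "eset G \<equiv> snd G"

definition simple_graph :: "'a ugraph \<Rightarrow> bool" where
  "simple_graph G \<longleftrightarrow> finite (vset G) \<and> (\<forall>e\<in>eset G. e \<subseteq> vset G \<and> card e = 2)"

definition is_subgraph :: "'a ugraph \<Rightarrow> 'a ugraph \<Rightarrow> bool" where
  "is_subgraph H G \<longleftrightarrow> simple_graph H \<and> vset H \<subseteq> vset G \<and> eset H \<subseteq> eset G"

definition bipartite_graph :: "'a ugraph \<Rightarrow> bool" where
  "bipartite_graph G \<longleftrightarrow> (\<exists>A B. A \<union> B = vset G \<and> A \<inter> B = {} \<and>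
     (\<forall>e\<in>eset G. \<exists>a\<in>A. \<exists>b\<in>B. e = {a, b}))"

definition induced_on :: "'a ugraph \<Rightarrow> 'a set \<Rightarrow> 'a ugraph" where
  "induced_on G W = (W, {e \<in> eset G. e \<subseteq> W})"

definition graph_iso :: "'a ugraph \<Rightarrow> 'b ugraph \<Rightarrow> bool" where
  "graph_iso G H \<longleftrightarrow> (\<exists>f. bij_betw f (vset G) (vset H) \<and>
     (\<forall>u\<in>vset G. \<forall>v\<in>vset G. {u, v} \<in> eset G \<longleftrightarrow> {f u, f v} \<in> eset H))"

definition contains_induced :: "'a ugraph \<Rightarrow> 'b ugraph \<Rightarrow> bool" where
  "contains_induced G F \<longleftrightarrow> (\<exists>W \<subseteq> vset G. graph_iso (induced_on G W) F)"

text \<open>The parts are the graphs \<open>P i\<close> with \<open>i < k\<close>; values of \<open>P\<close> at other indices are irrelevant.\<close>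

definition avoiding_bipartite_partition ::
    "'b ugraph set \<Rightarrow> 'a ugraph \<Rightarrow> nat \<Rightarrow> (nat \<Rightarrow> 'a ugraph) \<Rightarrow> bool" where
  "avoiding_bipartite_partition \<H> G k P \<longleftrightarrow>
     (\<forall>i<k. is_subgraph (P i) G \<and> bipartite_graph (P i)) \<and>
     (\<forall>i<k. \<forall>j<k. i \<noteq> j \<longrightarrow> eset (P i) \<inter> eset (P j) = {}) \<and>
     (\<Union>i<k. eset (P i)) = eset G \<and>
     (\<forall>i<k. \<forall>F\<in>\<H>. \<not> contains_induced (P i) F)"

text \<open>This is meaningful only if an avoiding partition exists; see
  \<open>ex_avoiding_bipartite_partition\<close> below for a sufficient condition.\<close>

definition chi_avoid :: "'b ugraph set \<Rightarrow> 'a ugraph \<Rightarrow> nat" where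
  "chi_avoid \<H> G = (LEAST k. \<exists>P. avoiding_bipartite_partition \<H> G k P)"

definition complete_graph :: "nat \<Rightarrow> nat ugraph" where
  "complete_graph n = ({..<n}, {{i, j} | i j. i < n \<and> j < n \<and> i \<noteq> j})"

definition path_graph :: "nat \<Rightarrow> nat ugraph" where
  "path_graph n = ({..<n}, {{i, Suc i} | i. Suc i < n})"

definition cycle_graph :: "nat \<Rightarrow> nat ugraph" where
  "cycle_graph n = ({..<n}, {{i, Suc i mod n} | i. i < n})"

text \<open>Here \<open>n\<close> counts all vertices, the centre included.\<close>

definition star_graph :: "nat \<Rightarrow> nat ugraph" where
  "star_graph n = ({..<n}, {{0, i} | i. 0 < i \<and> i < n})"

lemma ex_avoiding_bipartite_partition:
  fixes G :: "'a ugraph" and \<H> :: "'b ugraph set"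
  assumes G: "simple_graph G" and big: "\<And>F. F \<in> \<H> \<Longrightarrow> card (vset F) > 2"
  shows "\<exists>k P. avoiding_bipartite_partition \<H> G k P"
proof -
  have "eset G \<subseteq> Pow (vset G)" "finite (vset G)"
    using G by (auto simp: simple_graph_def)
  then have "finite (eset G)"
    by (meson finite_Pow_iff finite_subset)
  then obtain h where h: "bij_betw h {0..<card (eset G)} (eset G)"
    using ex_bij_betw_nat_finite by blast
  define k where "k = card (eset G)"
  define P where "P = (\<lambda>i. (h i, {h i}))"
  have hin: "h i \<in> eset G" if "i < k" for i
    using h that by (auto simp: bij_betw_def k_def)
  have hinj: "i = j" if "i < k" "j < k" "h i = h j" for i j
    using h that by (auto simp: bij_betw_def k_def inj_on_def)
  have two: "h i \<subseteq> vset G" "card (h i) = 2" if "i < k" for i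
    using hin[OF that] G by (auto simp: simple_graph_def)
  have sub: "is_subgraph (P i) G" if "i < k" for i
    using two[OF that] hin[OF that] by (auto simp: is_subgraph_def simple_graph_def P_def intro: card_ge_0_finite)
  have bip: "bipartite_graph (P i)" if i: "i < k" for i
  proof -
    obtain a b where "h i = {a, b}" "a \<noteq> b"
      using two(2)[OF i] by (auto simp: card_2_iff)
    then show ?thesis
      unfolding bipartite_graph_def P_def
      by (intro exI[of _ "{a}"] exI[of _ "{b}"]) auto
  qed
  have avoid: "\<not> contains_induced (P i) F" if i: "i < k" and F: "F \<in> \<H>" for i F
  proof
    assume "contains_induced (P i) F"
    then obtain W f where W: "W \<subseteq> h i" and f: "bij_betw f W (vset F)"
      by (auto simp: contains_induced_def graph_iso_def induced_on_def P_def)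
    have "card (vset F) = card W"
      using f by (simp add: bij_betw_same_card)
    also have "\<dots> \<le> 2"
      using W two(2)[OF i] by (metis card_mono card_ge_0_finite zero_less_numeral)
    finally show False
      using big[OF F] by simp
  qed
  have un: "(\<Union>i<k. eset (P i)) = eset G"
    using h by (auto simp: P_def k_def bij_betw_def lessThan_atLeast0)
  have "avoiding_bipartite_partition \<H> G k P"
    unfolding avoiding_bipartite_partition_def
    using sub bip avoid un hinj by (auto simp: P_def)
  then show ?thesis
    by blast
qed

end

theory Submission
  imports Defs "HOL-Number_Theory.Cong" "HOL-Real_Asymp.Real_Asymp"
begin

text \<open>
  A bipartite graph without induced \<open>P\<^sub>4\<close>, \<open>C\<^sub>4\<close>, \<open>S\<^sub>4\<close> is exactly a graph all of whose components are
  single vertices, single edges or cherries (paths with two edges). Such a graph on at most \<open>n\<close> vertices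
  has at most \<open>2n/3\<close> edges, which gives the lower bound \<open>3(n - 1)/4\<close>.

  For the upper bound, suppose \<open>K\<^sub>m\<close> is covered by \<open>k\<close> such forests and replace each vertex \<open>u\<close> by \<open>q\<close> copies
  \<open>(u, i)\<close>. For a forest \<open>F\<close> and \<open>s < q\<close>, joining \<open>(u, i)\<close> to \<open>(v, j)\<close> whenever \<open>uv\<close> is an edge of \<open>F\<close> and
  \<open>i + j\<close> is congruent to \<open>s\<close> modulo \<open>q\<close> yields disjoint copies of \<open>F\<close>, and these \<open>kq\<close> forests cover
  all edges between different groups. The groups themselves are disjoint copies of \<open>K\<^sub>q\<close> and are covered
  simultaneously. As \<open>K\<^sub>9\<close> decomposes into six spanning forests of three cherries each, this gives
  \<open>\<chi>'(9q) \<le> 6q + \<chi>'(q)\<close>, and hence \<open>\<chi>'(n) \<le> 3n/4 + O(log n)\<close>.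
\<close>

text \<open>The third clause speaks of walks rather than paths, so it excludes triangles as well.\<close>

definition cherry_forest :: "('a \<Rightarrow> 'a \<Rightarrow> bool) \<Rightarrow> bool" where
  "cherry_forest R \<longleftrightarrow> (\<forall>u. \<not> R u u) \<and> (\<forall>u v. R u v \<longrightarrow> R v u) \<and>
     (\<forall>u v w x. R u v \<and> R v w \<and> R w x \<longrightarrow> u = w \<or> v = x) \<and>
     (\<forall>v a b c. R v a \<and> R v b \<and> R v c \<longrightarrow> a = b \<or> a = c \<or> b = c)"

lemma cherry_forestD:
  assumes "cherry_forest R"
  shows "\<not> R u u" "R u v \<Longrightarrow> R v u"
    "R u v \<Longrightarrow> R v w \<Longrightarrow> R w x \<Longrightarrow> u = w \<or> v = x"
    "R v a \<Longrightarrow> R v b \<Longrightarrow> R v c \<Longrightarrow> a = b \<or> a = c \<or> b = c"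
  using assms unfolding cherry_forest_def by metis+

lemma cherry_forestI:
  assumes "\<And>u. \<not> R u u" "\<And>u v. R u v \<Longrightarrow> R v u"
    "\<And>u v w x. R u v \<Longrightarrow> R v w \<Longrightarrow> R w x \<Longrightarrow> u = w \<or> v = x"
    "\<And>v a b c. R v a \<Longrightarrow> R v b \<Longrightarrow> R v c \<Longrightarrow> a = b \<or> a = c \<or> b = c"
  shows "cherry_forest R"
  unfolding cherry_forest_def by (intro conjI allI impI; (elim conjE)?; rule assms)

lemma cherry_forest_subset:
  assumes R: "cherry_forest R" and sub: "\<And>u v. S u v \<Longrightarrow> R u v" and sym: "\<And>u v. S u v \<Longrightarrow> S v u"
  shows "cherry_forest S"
proof (rule cherry_forestI)
  show "\<not> S u u" for u
    using cherry_forestD(1)[OF R] sub by blast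
  show "S v u" if "S u v" for u v
    using that by (rule sym)
  show "u = w \<or> v = x" if "S u v" "S v w" "S w x" for u v w x
    using cherry_forestD(3)[OF R] sub that by blast
  show "a = b \<or> a = c \<or> b = c" if "S v a" "S v b" "S v c" for v a b c
    using cherry_forestD(4)[OF R] sub that by blast
qed

section \<open>The lower bound\<close>

lemma path_graph_4: "path_graph 4 = ({0, 1, 2, 3}, {{0, 1}, {1, 2}, {2, 3}})"
proof -
  have "{{i, Suc i} | i. Suc i < 4} = {{0, 1}, {1, 2}, {2, 3 :: nat}}" (is "?A = ?B")
  proof
    show "?A \<subseteq> ?B"
      by (auto simp: less_Suc_eq numeral_eq_Suc)
    show "?B \<subseteq> ?A"
      by (auto intro: exI[of _ 0] exI[of _ 1] exI[of _ 2])
  qed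
  moreover have "{..<4} = {0, 1, 2, 3 :: nat}"
    by auto
  ultimately show ?thesis
    by (simp add: path_graph_def)
qed

lemma cycle_graph_4: "cycle_graph 4 = ({0, 1, 2, 3}, {{0, 1}, {1, 2}, {2, 3}, {3, 0}})"
proof -
  have *: "{..<4} = {0, 1, 2, 3 :: nat}"
    by auto
  have "{{i, Suc i mod 4} | i. i < 4} = (\<lambda>i. {i, Suc i mod 4}) ` {..<4}"
    by auto
  moreover have "Suc 0 mod 4 = 1" "Suc 1 mod 4 = 2" "Suc 2 mod 4 = 3" "Suc 3 mod 4 = 0"
    by simp_all
  ultimately show ?thesis
    by (simp only: cycle_graph_def * image_insert image_empty)
qed

lemma star_graph_4: "star_graph 4 = ({0, 1, 2, 3}, {{0, 1}, {0, 2}, {0, 3}})"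
proof -
  have *: "{..<4} = {0, 1, 2, 3 :: nat}" "{i. 0 < i \<and> i < 4} = {1, 2, 3 :: nat}"
    by auto
  have "{{0, i} | i. 0 < i \<and> i < (4 :: nat)} = (\<lambda>i. {0, i}) ` {i. 0 < i \<and> i < 4}"
    by auto
  then show ?thesis
    unfolding * by (simp add: star_graph_def *)
qed

text \<open>Reduces the search for an induced four-vertex graph to its six pairs. Since
  \<open>graph_iso\<close> also compares the degenerate pairs \<open>{y, y} = {y}\<close>,
  looplessness on both sides settles the diagonal.\<close>

lemma contains_induced_4I:
  assumes W: "distinct [u, v, w, x]" "{u, v, w, x} \<subseteq> vset G"
    and loopless: "\<And>y. {y} \<notin> eset G" "\<And>i :: nat. {i} \<notin> E"
    and iff: "{u, v} \<in> eset G \<longleftrightarrow> {0, 1} \<in> E" "{u, w} \<in> eset G \<longleftrightarrow> {0, 2} \<in> E"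
      "{u, x} \<in> eset G \<longleftrightarrow> {0, 3} \<in> E" "{v, w} \<in> eset G \<longleftrightarrow> {1, 2} \<in> E"
      "{v, x} \<in> eset G \<longleftrightarrow> {1, 3} \<in> E" "{w, x} \<in> eset G \<longleftrightarrow> {2, 3} \<in> E"
  shows "contains_induced G ({0, 1, 2, 3}, E)"
proof -
  define f where "f y = (if y = u then 0 else if y = v then 1 else if y = w then 2 else 3 :: nat)" for y
  have f: "f u = 0" "f v = 1" "f w = 2" "f x = 3"
    using W(1) by (auto simp: f_def)
  have "bij_betw f {u, v, w, x} {0, 1, 2, 3}"
    unfolding bij_betw_def inj_on_def using f by simp
  moreover have "\<forall>a\<in>{u, v, w, x}. \<forall>b\<in>{u, v, w, x}. {a, b} \<in> eset G \<longleftrightarrow> {f a, f b} \<in> E"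
    using f loopless iff by (simp add: insert_commute)
  moreover define W where "W = {u, v, w, x}"
  ultimately have "bij_betw f W {0, 1, 2, 3}" "\<forall>a\<in>W. \<forall>b\<in>W. {a, b} \<in> eset G \<longleftrightarrow> {f a, f b} \<in> E"
    by blast+
  then have "graph_iso (induced_on G W) ({0, 1, 2, 3}, E)"
    unfolding graph_iso_def induced_on_def by (intro exI[of _ f]) simp
  moreover have "W \<subseteq> vset G"
    using W(2) by (simp add: W_def)
  ultimately show ?thesis
    unfolding contains_induced_def by (intro exI[of _ W] conjI)
qed

text \<open>In a bipartite graph, a walk \<open>u\<close>, \<open>v\<close>, \<open>w\<close>,
  \<open>x\<close> with \<open>u\<close> different from \<open>w\<close> and \<open>v\<close>
  different from \<open>x\<close> has four distinct vertices, and \<open>{u, x}\<close> is the only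
  further edge possible: its presence decides between an induced cycle and an induced path. Three
  neighbours of a vertex lie on one side, so they are pairwise non-adjacent and induce a star with
  it.\<close>

lemma cherry_forest_if_avoiding:
  assumes G: "simple_graph G" and bip: "bipartite_graph G"
    and avoid: "\<And>F. F \<in> {path_graph 4, cycle_graph 4, star_graph 4} \<Longrightarrow> \<not> contains_induced G F"
  shows "cherry_forest (\<lambda>u v. {u, v} \<in> eset G)"
proof -
  obtain A B where AB: "A \<inter> B = {}" "\<And>e. e \<in> eset G \<Longrightarrow> \<exists>a\<in>A. \<exists>b\<in>B. e = {a, b}"
    using bip unfolding bipartite_graph_def by metis
  have side: "(u \<in> A \<longleftrightarrow> v \<notin> A)" if "{u, v} \<in> eset G" for u v
    using AB(2)[OF that] AB(1) by (auto simp: doubleton_eq_iff)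
  have loopless: "{y} \<notin> eset G" for y
    using side[of y y] by auto
  have inV: "u \<in> vset G" "v \<in> vset G" if "{u, v} \<in> eset G" for u v
    using G that unfolding simple_graph_def by auto
  have lp: "{i} \<notin> {{0, 1}, {1, 2}, {2, 3 :: nat}}" "{i} \<notin> {{0, 1}, {1, 2}, {2, 3}, {3, 0 :: nat}}"
    "{i} \<notin> {{0, 1}, {0, 2}, {0, 3 :: nat}}" for i
    by auto
  show ?thesis
  proof (rule cherry_forestI)
    show "{u, u} \<notin> eset G" for u
      using loopless by simp
    show "{v, u} \<in> eset G" if "{u, v} \<in> eset G" for u v
      using that by (simp add: insert_commute)
    show "u = w \<or> v = x" if e: "{u, v} \<in> eset G" "{v, w} \<in> eset G" "{w, x} \<in> eset G" for u v w x
    proof (rule ccontr)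
      assume "\<not> (u = w \<or> v = x)"
      then have d: "distinct [u, v, w, x]"
        using side[OF e(1)] side[OF e(2)] side[OF e(3)] by auto
      have s: "{u, v, w, x} \<subseteq> vset G"
        using inV e by blast
      have n: "{u, w} \<notin> eset G" "{v, x} \<notin> eset G"
        using side[OF e(1)] side[OF e(2)] side[OF e(3)] side[of u w] side[of v x] by auto
      show False
      proof (cases "{u, x} \<in> eset G")
        case True
        have "contains_induced G (cycle_graph 4)"
          unfolding cycle_graph_4
          by (rule contains_induced_4I[OF d s loopless lp(2)])
            (use e n True in \<open>simp_all add: doubleton_eq_iff\<close>)
        then show False
          using avoid by blast
      next
        case False
        have "contains_induced G (path_graph 4)"
          unfolding path_graph_4
          by (rule contains_induced_4I[OF d s loopless lp(1)])
            (use e n False in \<open>simp_all add: doubleton_eq_iff\<close>)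
        then show False
          using avoid by blast
      qed
    qed
    show "a = b \<or> a = c \<or> b = c"
      if e: "{v, a} \<in> eset G" "{v, b} \<in> eset G" "{v, c} \<in> eset G" for v a b c
    proof (rule ccontr)
      assume "\<not> (a = b \<or> a = c \<or> b = c)"
      then have d: "distinct [v, a, b, c]"
        using side[OF e(1)] side[OF e(2)] side[OF e(3)] by auto
      have s: "{v, a, b, c} \<subseteq> vset G"
        using inV e by blast
      have n: "{a, b} \<notin> eset G" "{a, c} \<notin> eset G" "{b, c} \<notin> eset G"
        using side[OF e(1)] side[OF e(2)] side[OF e(3)] side[of a b] side[of a c] side[of b c] by auto
      have "contains_induced G (star_graph 4)"
        unfolding star_graph_4
        by (rule contains_induced_4I[OF d s loopless lp(3)])
          (use e n in \<open>simp_all add: doubleton_eq_iff\<close>)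
      then show False
        using avoid by blast
    qed
  qed
qed

text \<open>Components are never formed. Instead, disjoint sets of |E| leaves and at least |E|/2
  hubs are found among the vertices, so 3|E|/2 is at most |V|.\<close>

lemma cherry_forest_card_edges:
  assumes G: "simple_graph G" and cf: "cherry_forest (\<lambda>u v. {u, v} \<in> eset G)"
  shows "3 * card (eset G) \<le> 2 * card (vset G)"
proof -
  note cfD = cherry_forestD[OF cf]
  have fV: "finite (vset G)" and sub: "eset G \<subseteq> Pow (vset G)"
    using G by (auto simp: simple_graph_def)
  then have fE: "finite (eset G)"
    by (meson finite_Pow_iff finite_subset)
  \<comment> \<open>Split every edge into a leaf and a hub. Leaves are distinct for distinct edges, no leaf is a hub,
    and a hub serves at most two edges.\<close>
  have "\<exists>l h. e = {l, h} \<and> (\<forall>z. {l, z} \<in> eset G \<longrightarrow> z = h)" if e: "e \<in> eset G" for e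
  proof -
    obtain a b where ab: "e = {a, b}"
      using e G by (auto simp: simple_graph_def card_2_iff)
    show ?thesis
    proof (cases "\<forall>z. {a, z} \<in> eset G \<longrightarrow> z = b")
      case True
      then show ?thesis using ab by blast
    next
      case False
      then obtain z where z: "{a, z} \<in> eset G" "z \<noteq> b"
        by blast
      \<comment> \<open>The walk \<open>z\<close>, \<open>a\<close>, \<open>b\<close>,
        \<open>y\<close> with \<open>z\<close> different from \<open>b\<close> forces
        \<open>y = a\<close>. So \<open>b\<close> can be the leaf and \<open>a\<close> the
        hub.\<close>
      have "y = a" if "{b, y} \<in> eset G" for y
        using cfD(3)[of z a b y] z that e ab by (auto simp: insert_commute)
      then show ?thesis using ab by (metis insert_commute)
    qed
  qed
  then obtain l h where lh: "\<And>e. e \<in> eset G \<Longrightarrow> e = {l e, h e}"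
    and leaf: "\<And>e z. e \<in> eset G \<Longrightarrow> {l e, z} \<in> eset G \<Longrightarrow> z = h e"
    by metis
  have inj: "inj_on l (eset G)"
    by (rule inj_onI) (metis lh leaf)
  have disj: "l ` eset G \<inter> h ` eset G = {}"
  proof -
    \<comment> \<open>If the leaf of \<open>e\<close> were the hub of \<open>f\<close>, then
      \<open>l f\<close> would be a neighbour of that leaf and hence equal to \<open>h e\<close>.
      This makes \<open>e\<close> and \<open>f\<close> the same edge, which would then be a
      loop.\<close>
    have False if "e \<in> eset G" "f \<in> eset G" "l e = h f" for e f
    proof -
      have "{l e, l f} \<in> eset G"
        using lh[OF that(2)] that by (simp add: insert_commute)
      then have "l f = h e"
        using leaf that(1) by blast
      then have "e = f"
        using lh that by (metis insert_commute)
      then show False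
        using lh that cfD(1) by metis
    qed
    then show ?thesis by blast
  qed
  have fibre: "card {e \<in> eset G. h e = v} \<le> 2" for v
  proof (rule ccontr)
    assume "\<not> ?thesis"
    then have "3 \<le> card {e \<in> eset G. h e = v}"
      by simp
    then obtain T where T: "T \<subseteq> {e \<in> eset G. h e = v}" "card T = 3"
      by (meson obtain_subset_with_card_n)
    then obtain a b c where abc: "T = {a, b, c}" "a \<noteq> b" "a \<noteq> c" "b \<noteq> c"
      by (auto simp: card_3_iff)
    have "{v, l e} \<in> eset G" if "e \<in> T" for e
      using lh T that by (metis (mono_tags, lifting) insert_commute mem_Collect_eq subsetD)
    then have "l a = l b \<or> l a = l c \<or> l b = l c"
      using cfD(4)[of v "l a" "l b" "l c"] abc by blast
    then show False
      using inj T(1) abc by (auto simp: inj_on_def)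
  qed
  have "eset G = (\<Union>v\<in>h ` eset G. {e \<in> eset G. h e = v})"
    by auto
  then have "card (eset G) \<le> (\<Sum>v\<in>h ` eset G. card {e \<in> eset G. h e = v})"
    using card_UN_le[of "h ` eset G" "\<lambda>v. {e \<in> eset G. h e = v}"] fE by simp
  also have "\<dots> \<le> card (h ` eset G) * 2"
    using sum_bounded_above[of "h ` eset G" "\<lambda>v. card {e \<in> eset G. h e = v}" 2] fibre by simp
  finally have "card (eset G) \<le> 2 * card (h ` eset G)"
    by simp
  moreover have "card (l ` eset G) + card (h ` eset G) \<le> card (vset G)"
  proof -
    have "l ` eset G \<union> h ` eset G \<subseteq> vset G"
      using lh sub by blast
    then have "card (l ` eset G \<union> h ` eset G) \<le> card (vset G)"
      using fV by (intro card_mono)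
    then show ?thesis
      using fE disj by (simp add: card_Un_disjoint)
  qed
  moreover have "card (l ` eset G) = card (eset G)"
    using inj by (rule card_image)
  ultimately show ?thesis
    by simp
qed

section \<open>Counting the edges of the complete graph\<close>

lemma eset_complete_graph: "eset (complete_graph n) = {e. e \<subseteq> {..<n} \<and> card e = 2}"
  by (auto simp: complete_graph_def card_2_iff)

lemma avoiding_partition_lower_bound:
  assumes "avoiding_bipartite_partition {path_graph 4, cycle_graph 4, star_graph 4} (complete_graph n) k P"
  shows "3 / 4 * real n - 1 \<le> real k"
proof (cases "n = 0")
  case False
  have bound: "3 * card (eset (P i)) \<le> 2 * n" if i: "i < k" for i
  proof -
    have P: "is_subgraph (P i) (complete_graph n)" and bip: "bipartite_graph (P i)"
      using assms i by (simp_all only: avoiding_bipartite_partition_def)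
    have avoid: "\<forall>F\<in>{path_graph 4, cycle_graph 4, star_graph 4}. \<not> contains_induced (P i) F"
      using assms i by (simp add: avoiding_bipartite_partition_def)
    have "simple_graph (P i)"
      using P by (simp add: is_subgraph_def)
    then have "cherry_forest (\<lambda>u v. {u, v} \<in> eset (P i))"
      using bip avoid cherry_forest_if_avoiding by metis
    then have "3 * card (eset (P i)) \<le> 2 * card (vset (P i))"
      using P cherry_forest_card_edges unfolding is_subgraph_def by blast
    also have "card (vset (P i)) \<le> card {..<n}"
      using P unfolding is_subgraph_def by (intro card_mono) (auto simp: complete_graph_def)
    finally show ?thesis by simp
  qed
  have "n choose 2 = card (\<Union>i<k. eset (P i))"
    using assms n_subsets[of "{..<n}" 2]
    by (simp add: avoiding_bipartite_partition_def eset_complete_graph)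
  also have "\<dots> \<le> (\<Sum>i<k. card (eset (P i)))"
    by (rule card_UN_le) simp
  finally have "3 * (n choose 2) \<le> (\<Sum>i<k. 3 * card (eset (P i)))"
    by (simp add: sum_distrib_left[symmetric])
  also have "\<dots> \<le> k * (2 * n)"
    using sum_bounded_above[of "{..<k}" "\<lambda>i. 3 * card (eset (P i))" "2 * n"] bound by simp
  finally have "3 * (n choose 2) \<le> k * (2 * n)" .
  then have "3 * real (n choose 2) \<le> real k * (2 * real n)"
    by (metis of_nat_le_iff of_nat_mult of_nat_numeral)
  moreover have "real (n choose 2) = real n * (real n - 1) / 2"
    by (simp add: binomial_gbinomial gbinomial_prod_rev numeral_2_eq_2)
  \<comment> \<open>The edge count bounds \<open>k\<close> only after cancelling the common factor
    \<open>n\<close>, hence the separate case \<open>n = 0\<close>.\<close>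
  ultimately have "real n * (3 * (real n - 1)) \<le> real n * (4 * real k)"
    by (simp add: algebra_simps)
  then have "3 * (real n - 1) \<le> 4 * real k"
    using False by (simp add: mult_le_cancel_left_pos)
  then show ?thesis
    by simp
qed simp

section \<open>The upper bound\<close>

text \<open>A cover suffices, because cherry forests are closed under deleting edges.\<close>

definition cherry_coverable :: "nat \<Rightarrow> nat \<Rightarrow> bool" where
  "cherry_coverable n k \<longleftrightarrow> (\<exists>R. (\<forall>t<k. cherry_forest (R t)) \<and>
     (\<forall>u<n. \<forall>v<n. u \<noteq> v \<longrightarrow> (\<exists>t<k. R t u v)))"

section \<open>From covers by cherry forests to avoiding partitions\<close>

lemma cherry_forest_bipartition:
  fixes R :: "'a :: linorder \<Rightarrow> 'a \<Rightarrow> bool"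
  assumes "cherry_forest R"
  obtains B where "\<And>u v. R u v \<Longrightarrow> u \<in> B \<longleftrightarrow> v \<notin> B"
proof -
  note D = cherry_forestD[OF assms]
  \<comment> \<open>\<open>B\<close> contains the centres of the cherries and the smaller vertex of each isolated edge.\<close>
  define B where "B = {v. \<exists>u. R v u \<and> (v < u \<or> (\<exists>w. w \<noteq> u \<and> R v w)) \<and> (\<forall>w. R u w \<longrightarrow> w = v)}"
  have "u \<in> B \<longleftrightarrow> v \<notin> B" if uv: "R u v" for u v
  proof -
    have "u \<noteq> v" "R v u"
      using D uv by blast+
    \<comment> \<open>Either \<open>u\<close> is the centre of a cherry, or \<open>v\<close> is, or
      the edge is isolated. In the first two cases the walk condition leaves the other end with a
      single neighbour.\<close>
    consider "\<exists>w. w \<noteq> v \<and> R u w" | "\<exists>w. w \<noteq> u \<and> R v w"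
      | "\<forall>w. R u w \<longrightarrow> w = v" "\<forall>w. R v w \<longrightarrow> w = u"
      by blast
    then show ?thesis
    proof cases
      case 1
      then have "\<forall>w. R v w \<longrightarrow> w = u"
        using D(2,3) uv by metis
      then show ?thesis
        unfolding B_def using 1 uv \<open>R v u\<close> by blast
    next
      case 2
      then have "\<forall>w. R u w \<longrightarrow> w = v"
        using D(2,3) uv by metis
      then show ?thesis
        unfolding B_def using 2 uv \<open>R v u\<close> by blast
    next
      case 3
      then have "u \<in> B \<longleftrightarrow> u < v" "v \<in> B \<longleftrightarrow> v < u"
        unfolding B_def using uv \<open>R v u\<close> by blast+
      then show ?thesis
        using \<open>u \<noteq> v\<close> by auto
    qed
  qed
  then show ?thesis
    by (rule that)
qed

text \<open>Cherry forests exclude the three graphs even as non-induced subgraphs, so preservation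
  of edges is all that is extracted.\<close>

lemma contains_induced_4D:
  assumes "contains_induced G ({0, 1, 2, 3 :: nat}, E)"
  obtains g where "distinct [g 0, g 1, g 2, g (3 :: nat)]"
    "\<forall>i\<in>{0, 1, 2, 3}. \<forall>j\<in>{0, 1, 2, 3}. {i, j} \<in> E \<longrightarrow> {g i, g j} \<in> eset G"
proof -
  obtain W f where f: "bij_betw f W {0, 1, 2, 3 :: nat}"
    and iff: "\<And>u v. u \<in> W \<Longrightarrow> v \<in> W \<Longrightarrow> {u, v} \<in> eset G \<longleftrightarrow> {f u, f v} \<in> E"
    using assms unfolding contains_induced_def graph_iso_def induced_on_def by auto
  define g where "g = inv_into W f"
  have g: "g i \<in> W" "f (g i) = i" if "i \<in> {0, 1, 2, 3}" for i
    using f that by (auto simp: g_def bij_betw_def inv_into_into f_inv_into_f)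
  have "distinct [g 0, g 1, g 2, g 3]"
    using g(2)[of 0] g(2)[of 1] g(2)[of 2] g(2)[of 3] by auto
  moreover have "\<forall>i\<in>{0, 1, 2, 3}. \<forall>j\<in>{0, 1, 2, 3}. {i, j} \<in> E \<longrightarrow> {g i, g j} \<in> eset G"
    using iff g by metis
  ultimately show ?thesis
    by (rule that)
qed

text \<open>The path and the cycle share the walk 0, 1, 2, 3, which the walk condition forbids; the
  star violates the degree condition at its centre.\<close>

lemma cherry_forest_avoids:
  assumes cf: "cherry_forest (\<lambda>u v. {u, v} \<in> eset G)"
    and F: "F \<in> {path_graph 4, cycle_graph 4, star_graph 4}"
  shows "\<not> contains_induced G F"
proof
  assume "contains_induced G F"
  moreover obtain E where E: "F = ({0, 1, 2, 3}, E)"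
    and edges: "({0, 1} \<in> E \<and> {1, 2} \<in> E \<and> {2, 3} \<in> E) \<or> ({0, 1} \<in> E \<and> {0, 2} \<in> E \<and> {0, 3} \<in> E)"
    using F by (auto simp: path_graph_4 cycle_graph_4 star_graph_4)
  ultimately have "contains_induced G ({0, 1, 2, 3}, E)"
    by simp
  then obtain g where g: "distinct [g 0, g 1, g 2, g (3 :: nat)]"
    "\<forall>i\<in>{0, 1, 2, 3}. \<forall>j\<in>{0, 1, 2, 3}. {i, j} \<in> E \<longrightarrow> {g i, g j} \<in> eset G"
    by (rule contains_induced_4D)
  from edges show False
  proof
    assume "{0, 1} \<in> E \<and> {1, 2} \<in> E \<and> {2, 3} \<in> E"
    then show False
      using cherry_forestD(3)[OF cf, of "g 0" "g 1" "g 2" "g 3"] g by auto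
  next
    assume "{0, 1} \<in> E \<and> {0, 2} \<in> E \<and> {0, 3} \<in> E"
    then show False
      using cherry_forestD(4)[OF cf, of "g 0" "g 1" "g 2" "g 3"] g by auto
  qed
qed

lemma cherry_coverable_imp_avoiding_partition:
  assumes "cherry_coverable n k"
  shows "\<exists>P. avoiding_bipartite_partition {path_graph 4, cycle_graph 4, star_graph 4} (complete_graph n) k P"
proof -
  obtain R where R: "\<And>t. t < k \<Longrightarrow> cherry_forest (R t)"
    and cover: "\<And>u v. u < n \<Longrightarrow> v < n \<Longrightarrow> u \<noteq> v \<Longrightarrow> \<exists>t<k. R t u v"
    using assms unfolding cherry_coverable_def by blast
  \<comment> \<open>Each edge goes to the first forest that covers it, which makes the parts
    disjoint. By symmetry of the forests this choice does not depend on the orientation of the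
    edge.\<close>
  define S where "S t u v \<longleftrightarrow> u < n \<and> v < n \<and> R t u v \<and> (\<forall>j<t. \<not> R j u v)" for t u v
  define P where "P t = ({..<n}, {{u, v} | u v. S t u v})" for t
  have Ssym: "S t v u" if "t < k" "S t u v" for t u v
    using that cherry_forestD(2)[OF R] unfolding S_def by (meson less_trans)
  have S: "cherry_forest (S t)" if "t < k" for t
    using R[OF that] _ Ssym[OF that] by (rule cherry_forest_subset) (simp add: S_def)
  have edge: "{u, v} \<in> eset (P t) \<longleftrightarrow> S t u v" if "t < k" for t u v
    using Ssym[OF that] by (auto simp: P_def doubleton_eq_iff)
  have edgeE: "\<exists>u v. e = {u, v} \<and> S t u v \<and> u \<noteq> v" if "t < k" "e \<in> eset (P t)" for t e
    using that cherry_forestD(1)[OF S] by (fastforce simp: P_def)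
  have sub: "is_subgraph (P t) (complete_graph n)" if "t < k" for t
  proof -
    have "e \<subseteq> {..<n} \<and> card e = 2" if "e \<in> eset (P t)" for e
      using edgeE[OF \<open>t < k\<close> that] by (auto simp: S_def)
    then show ?thesis
      unfolding is_subgraph_def simple_graph_def eset_complete_graph
      by (auto simp: P_def complete_graph_def)
  qed
  have bip: "bipartite_graph (P t)" if t: "t < k" for t
  proof -
    obtain B where B: "\<And>u v. S t u v \<Longrightarrow> u \<in> B \<longleftrightarrow> v \<notin> B"
      using cherry_forest_bipartition[OF S[OF t]] by blast
    have "\<exists>a\<in>{..<n} \<inter> B. \<exists>b\<in>{..<n} - B. e = {a, b}" if e: "e \<in> eset (P t)" for e
    proof -
      obtain u v where uv: "e = {u, v}" "S t u v"
        using edgeE[OF t e] by blast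
      then have "u < n" "v < n"
        by (simp_all add: S_def)
      then show ?thesis
        using B[OF uv(2)] uv(1) by (cases "u \<in> B") (auto simp: insert_commute)
    qed
    then show ?thesis
      unfolding bipartite_graph_def
      by (intro exI[of _ "{..<n} \<inter> B"] exI[of _ "{..<n} - B"]) (auto simp: P_def)
  qed
  have disj: "eset (P i) \<inter> eset (P j) = {}" if "i < k" "j < k" "i \<noteq> j" for i j
  proof -
    have False if e: "e \<in> eset (P i)" "e \<in> eset (P j)" for e
    proof -
      obtain u v where "e = {u, v}" "S i u v"
        using edgeE \<open>i < k\<close> e(1) by blast
      then have "S j u v" "S i u v"
        using edge \<open>j < k\<close> e(2) by blast+
      then show False
        using \<open>i \<noteq> j\<close> unfolding S_def by (meson linorder_neqE_nat)
    qed
    then show ?thesis by blast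
  qed
  have un: "(\<Union>i<k. eset (P i)) = eset (complete_graph n)"
  proof
    show "(\<Union>i<k. eset (P i)) \<subseteq> eset (complete_graph n)"
      using sub unfolding is_subgraph_def by blast
    show "eset (complete_graph n) \<subseteq> (\<Union>i<k. eset (P i))"
    proof
      fix e assume "e \<in> eset (complete_graph n)"
      then obtain u v where uv: "e = {u, v}" "u < n" "v < n" "u \<noteq> v"
        by (auto simp: complete_graph_def)
      define t where "t = (LEAST t. R t u v)"
      obtain t0 where t0: "t0 < k" "R t0 u v"
        using cover uv by blast
      have "R t u v" "t < k"
        unfolding t_def using t0 LeastI[of "\<lambda>t. R t u v"] Least_le[of "\<lambda>t. R t u v" t0] by auto
      moreover have "\<forall>j<t. \<not> R j u v"
        unfolding t_def using not_less_Least by blast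
      ultimately show "e \<in> (\<Union>i<k. eset (P i))"
        using uv edge[of t u v] by (auto simp: S_def)
    qed
  qed
  have "cherry_forest (\<lambda>u v. {u, v} \<in> eset (P t))" if "t < k" for t
    using S[OF that] edge[OF that] by simp
  then have "\<not> contains_induced (P t) F" if "t < k" "F \<in> {path_graph 4, cycle_graph 4, star_graph 4}" for t F
    using cherry_forest_avoids that by blast
  then have "avoiding_bipartite_partition {path_graph 4, cycle_graph 4, star_graph 4} (complete_graph n) k P"
    unfolding avoiding_bipartite_partition_def using sub bip disj un by blast
  then show ?thesis by blast
qed

section \<open>Blowing up a cover\<close>

lemma cherry_coverableI:
  assumes "\<And>t. t < k \<Longrightarrow> cherry_forest (R t)"
    and "\<And>u v. u < n \<Longrightarrow> v < n \<Longrightarrow> u \<noteq> v \<Longrightarrow> \<exists>t<k. R t u v"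
  shows "cherry_coverable n k"
  unfolding cherry_coverable_def using assms by (intro exI[of _ R]) simp

lemma cherry_coverable_mono:
  assumes "cherry_coverable n k" "m \<le> n"
  shows "cherry_coverable m k"
proof -
  obtain R where "\<And>t. t < k \<Longrightarrow> cherry_forest (R t)"
    and "\<And>u v. u < n \<Longrightarrow> v < n \<Longrightarrow> u \<noteq> v \<Longrightarrow> \<exists>t<k. R t u v"
    using assms(1) unfolding cherry_coverable_def by blast
  then show ?thesis
    using assms(2) by (intro cherry_coverableI[of k R]) simp_all
qed

lemma cherry_coverable_mult:
  assumes m: "cherry_coverable m k" and q: "cherry_coverable q l"
  shows "cherry_coverable (m * q) (k * q + l)"
proof (cases "q = 0")
  case True
  then show ?thesis
    by (simp add: cherry_coverable_def) (use q in \<open>auto simp: cherry_coverable_def\<close>)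
next
  case False
  then have q0: "0 < q" by simp
  obtain R where R: "\<And>t. t < k \<Longrightarrow> cherry_forest (R t)"
    and Rc: "\<And>u v. u < m \<Longrightarrow> v < m \<Longrightarrow> u \<noteq> v \<Longrightarrow> \<exists>t<k. R t u v"
    using m unfolding cherry_coverable_def by blast
  obtain S where S: "\<And>t. t < l \<Longrightarrow> cherry_forest (S t)"
    and Sc: "\<And>u v. u < q \<Longrightarrow> v < q \<Longrightarrow> u \<noteq> v \<Longrightarrow> \<exists>t<l. S t u v"
    using q unfolding cherry_coverable_def by blast
  \<comment> \<open>Copy \<open>i\<close> of vertex \<open>u\<close> is encoded as
    \<open>u * q + i\<close>, so the groups are blocks of \<open>q\<close> consecutive numbers. Each
    \<open>Y t\<close> serves all blocks at once, so the edges inside the groups cost only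
    \<open>l\<close> further forests.\<close>
  define X where "X t s x y \<longleftrightarrow> R t (x div q) (y div q) \<and> (x mod q + y mod q) mod q = s" for t s x y
  define Y where "Y t x y \<longleftrightarrow> x div q = y div q \<and> S t (x mod q) (y mod q)" for t x y
  have same: "x = y" if "x div q = y div q" "x mod q = y mod q" for x y
    using that by (metis div_mult_mod_eq)
  have cancel: "y mod q = z mod q"
    if "(x mod q + y mod q) mod q = s" "(x mod q + z mod q) mod q = s" for x y z s
  proof -
    have "[x + y = x + z] (mod q)"
      using that by (simp add: Cong.cong_def mod_simps)
    then have "[y = z] (mod q)"
      by (simp only: cong_add_lcancel_nat)
    then show ?thesis
      by (simp add: Cong.cong_def)
  qed
  have X: "cherry_forest (X t s)" if "t < k" for t s
  proof (rule cherry_forestI)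
    note D = cherry_forestD[OF R[OF that]]
    show "\<not> X t s u u" for u
      using D(1) by (simp add: X_def)
    show sym: "X t s v u" if "X t s u v" for u v
      using that D(2) by (auto simp: X_def add.commute)
    \<comment> \<open>Two neighbours of \<open>v\<close> in the same group coincide, because
      \<open>v\<close> and \<open>s\<close> determine the residue of a neighbour. Hence distinct
      neighbours project to distinct neighbours in \<open>R t\<close>, and both remaining conditions
      are inherited from \<open>R t\<close>.\<close>
    have eq: "u = w" if "X t s v u" "X t s v w" "u div q = w div q" for u v w
      using that cancel same unfolding X_def by blast
    show "u = w \<or> v = x" if "X t s u v" "X t s v w" "X t s w x" for u v w x
      using D(3)[of "u div q" "v div q" "w div q" "x div q"] that eq sym unfolding X_def
      by (metis X_def)
    show "a = b \<or> a = c \<or> b = c" if "X t s v a" "X t s v b" "X t s v c" for v a b c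
      using D(4)[of "v div q" "a div q" "b div q" "c div q"] that eq by (metis X_def)
  qed
  have Y: "cherry_forest (Y t)" if "t < l" for t
  proof (rule cherry_forestI)
    note D = cherry_forestD[OF S[OF that]]
    show "\<not> Y t u u" for u
      using D(1) by (simp add: Y_def)
    show "Y t v u" if "Y t u v" for u v
      using that D(2) by (auto simp: Y_def)
    show "u = w \<or> v = x" if "Y t u v" "Y t v w" "Y t w x" for u v w x
      using D(3)[of "u mod q" "v mod q" "w mod q" "x mod q"] that same unfolding Y_def by metis
    show "a = b \<or> a = c \<or> b = c" if "Y t v a" "Y t v b" "Y t v c" for v a b c
      using D(4)[of "v mod q" "a mod q" "b mod q" "c mod q"] that same unfolding Y_def by metis
  qed
  \<comment> \<open>The first \<open>k * q\<close> indices list the pairs \<open>(t, s)\<close> as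
    \<open>t * q + s\<close>; the last \<open>l\<close> indices are for the edges inside the
    groups.\<close>
  define Z where "Z t = (if t < k * q then X (t div q) (t mod q) else Y (t - k * q))" for t
  have "cherry_forest (Z t)" if "t < k * q + l" for t
    using that X[of "t div q"] Y[of "t - k * q"] q0 by (auto simp: Z_def less_mult_imp_div_less)
  moreover have "\<exists>t<k * q + l. Z t x y" if xy: "x < m * q" "y < m * q" "x \<noteq> y" for x y
  proof (cases "x div q = y div q")
    case True
    then have "x mod q \<noteq> y mod q"
      using same xy by blast
    then obtain t where "t < l" "S t (x mod q) (y mod q)"
      using Sc[of "x mod q" "y mod q"] q0 by auto
    then show ?thesis
      using True by (intro exI[of _ "k * q + t"]) (simp add: Z_def Y_def)
  next
    case False
    then obtain t where t: "t < k" "R t (x div q) (y div q)"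
      using Rc[of "x div q" "y div q"] xy by (auto simp: less_mult_imp_div_less)
    define s where "s = (x mod q + y mod q) mod q"
    have "s < q"
      using q0 by (simp add: s_def)
    have "t * q + s < Suc t * q"
      using \<open>s < q\<close> by simp
    also have "\<dots> \<le> k * q"
      using t(1) by (intro mult_le_mono1) simp
    finally have "t * q + s < k * q" .
    then show ?thesis
      using t \<open>s < q\<close> by (intro exI[of _ "t * q + s"]) (simp add: Z_def X_def s_def)
  qed
  ultimately show ?thesis
    by (rule cherry_coverableI)
qed

section \<open>Decomposing the complete graph on nine vertices\<close>

definition cherry :: "'a \<times> 'a \<times> 'a \<Rightarrow> 'a \<Rightarrow> 'a \<Rightarrow> bool" where
  "cherry = (\<lambda>(a, b, c) u v. u = b \<and> (v = a \<or> v = c) \<or> v = b \<and> (u = a \<or> u = c))"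

text \<open>The cherries are vertex-disjoint, so by \<open>out\<close> no edge of the remaining
  forest meets the new cherry. Every walk or star therefore lies entirely in the new cherry or
  entirely in the rest.\<close>

lemma cherry_forest_cherries:
  assumes "distinct (concat (map (\<lambda>(a, b, c). [a, b, c]) L))"
  shows "cherry_forest (\<lambda>u v. \<exists>p\<in>set L. cherry p u v)"
  using assms
proof (induction L)
  case Nil
  then show ?case
    by (simp add: cherry_forest_def)
next
  case (Cons p L)
  obtain a b c where p: "p = (a, b, c)"
    by (cases p)
  define S where "S = (\<lambda>u v. \<exists>p\<in>set L. cherry p u v)"
  have S: "cherry_forest S"
    using Cons by (simp add: S_def)
  note D = cherry_forestD[OF S]
  have abc: "a \<noteq> b" "a \<noteq> c" "b \<noteq> c"
    using Cons.prems p by auto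
  have out: "u \<notin> {a, b, c}" "v \<notin> {a, b, c}" if "S u v" for u v
    using that Cons.prems p by (fastforce simp: S_def cherry_def)+
  have "cherry_forest (\<lambda>u v. cherry (a, b, c) u v \<or> S u v)"
  proof (rule cherry_forestI)
    show "\<not> (cherry (a, b, c) u u \<or> S u u)" for u
      using abc D(1) by (auto simp: cherry_def)
    show "cherry (a, b, c) v u \<or> S v u" if "cherry (a, b, c) u v \<or> S u v" for u v
      using that D(2) by (auto simp: cherry_def)
    show "u = w \<or> v = x" if "cherry (a, b, c) u v \<or> S u v"
      "cherry (a, b, c) v w \<or> S v w" "cherry (a, b, c) w x \<or> S w x" for u v w x
      using that abc D(3)[of u v w x] out unfolding cherry_def by auto
    show "x = y \<or> x = z \<or> y = z" if "cherry (a, b, c) v x \<or> S v x"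
      "cherry (a, b, c) v y \<or> S v y" "cherry (a, b, c) v z \<or> S v z" for v x y z
      using that abc D(4)[of v x y z] out unfolding cherry_def by auto
  qed
  then show ?case
    by (simp add: p S_def)
qed

text \<open>Found by computer search: six spanning forests of three cherries, with the centre in the middle.\<close>

definition design9 :: "(nat \<times> nat \<times> nat) list list" where
  "design9 =
    [[(1, 0, 3), (2, 4, 5), (6, 8, 7)],
     [(2, 0, 6), (3, 1, 8), (4, 7, 5)],
     [(0, 4, 1), (7, 2, 8), (5, 3, 6)],
     [(0, 5, 6), (2, 1, 7), (4, 3, 8)],
     [(0, 7, 3), (1, 5, 8), (2, 6, 4)],
     [(0, 8, 4), (1, 6, 7), (3, 2, 5)]]"

text \<open>Six forests with six edges each have 36 edges, exactly the number of pairs from nine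
  vertices, so no edge is wasted. This efficiency yields the constant 3/4 in the recursion, as (6/9)
  / (1 - 1/9) = 3/4.\<close>

lemma cherry_coverable_9: "cherry_coverable 9 6"
proof -
  have len: "length design9 = 6"
    by (simp add: design9_def)
  have "\<forall>L\<in>set design9. distinct (concat (map (\<lambda>(a, b, c). [a, b, c]) L))"
    by (simp add: design9_def)
  then have "cherry_forest (\<lambda>u v. \<exists>p\<in>set (design9 ! t). cherry p u v)" if "t < 6" for t
    using that len by (intro cherry_forest_cherries) (metis nth_mem)
  moreover have "\<exists>t<6. \<exists>p\<in>set (design9 ! t). cherry p u v" if "u < 9" "v < 9" "u \<noteq> v" for u v
  proof -
    have nine: "{..<9} = {0, 1, 2, 3, 4, 5, 6, 7, 8 :: nat}"
      by auto
    have "\<forall>u\<in>{..<9}. \<forall>v\<in>{..<9}. u \<noteq> v \<longrightarrow> (\<exists>L\<in>set design9. \<exists>p\<in>set L. cherry p u v)"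
      unfolding nine by (simp add: design9_def cherry_def)
    then obtain L where "L \<in> set design9" "\<exists>p\<in>set L. cherry p u v"
      using \<open>u < 9\<close> \<open>v < 9\<close> \<open>u \<noteq> v\<close> by blast
    then show ?thesis
      using len by (metis in_set_conv_nth)
  qed
  ultimately show ?thesis
    by (rule cherry_coverableI)
qed

section \<open>Recursion and asymptotics\<close>

lemma cherry_coverable_bound:
  assumes "n \<le> 9 ^ j"
  shows "\<exists>k. cherry_coverable n k \<and> real k \<le> 3 / 4 * real n + 6 * real j"
  using assms
proof (induction j arbitrary: n)
  case 0
  then have "cherry_coverable n 0"
    by (simp add: cherry_coverable_def)
  then show ?case
    by (intro exI[of _ 0]) simp
next
  case (Suc j)
  \<comment> \<open>Rounds \<open>n\<close> up to the multiple \<open>9 * q\<close>. The total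
    coefficient of \<open>q\<close> is 6 + 3/4 = 27/4, and 9q is at most n + 8, so rounding costs at
    most (3/4) * 8 = 6 forests per level.\<close>
  define q where "q = (n + 8) div 9"
  have q: "n \<le> 9 * q" "9 * q \<le> n + 8" "q \<le> 9 ^ j"
    using Suc.prems unfolding q_def by auto
  obtain k where k: "cherry_coverable q k" "real k \<le> 3 / 4 * real q + 6 * real j"
    using Suc.IH[OF q(3)] by blast
  have "cherry_coverable n (6 * q + k)"
    using cherry_coverable_mono[OF cherry_coverable_mult[OF cherry_coverable_9 k(1)] q(1)] .
  moreover have "real (6 * q + k) \<le> 3 / 4 * real n + 6 * real (Suc j)"
    using k(2) q(2) by simp
  ultimately show ?case
    by blast
qed

theorem mainTheorem4:
  "(\<lambda>n. real (chi_avoid {path_graph 4, cycle_graph 4, star_graph 4} (complete_graph n))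
        - 3 / 4 * real n) \<in> o(\<lambda>n. real n)"
proof -
  define \<chi> where "\<chi> n = real (chi_avoid {path_graph 4, cycle_graph 4, star_graph 4} (complete_graph n))" for n
  have bound: "\<bar>\<chi> n - 3 / 4 * real n\<bar> \<le> 6 * (log 9 (real n) + 1)" if n: "n \<ge> 1" for n
  proof -
    \<comment> \<open>The recursion depth: rounding the logarithm up gives
      \<open>n \<le> 9 ^ j\<close> at the price of the summand 1 in the bound.\<close>
    define j where "j = nat \<lceil>log 9 (real n)\<rceil>"
    have "real n = 9 powr log 9 (real n)"
      using n by simp
    also have "\<dots> \<le> 9 powr real j"
      unfolding j_def by (intro powr_mono) (use of_nat_ceiling in auto)
    also have "\<dots> = real (9 ^ j)"
      by (simp add: powr_realpow)
    finally have "n \<le> 9 ^ j"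
      by (simp only: of_nat_le_iff)
    then obtain k where k: "cherry_coverable n k" "real k \<le> 3 / 4 * real n + 6 * real j"
      using cherry_coverable_bound by blast
    have ex: "\<exists>P. avoiding_bipartite_partition {path_graph 4, cycle_graph 4, star_graph 4} (complete_graph n) k P"
      using cherry_coverable_imp_avoiding_partition[OF k(1)] .
    have "\<chi> n \<le> real k"
      unfolding \<chi>_def chi_avoid_def using Least_le[of _ k] ex by simp
    \<comment> \<open>As some partition exists, the least number of parts is attained, so the lower
      bound applies to \<open>chi_avoid\<close> itself.\<close>
    moreover have "\<exists>P. avoiding_bipartite_partition {path_graph 4, cycle_graph 4, star_graph 4}
        (complete_graph n) (chi_avoid {path_graph 4, cycle_graph 4, star_graph 4} (complete_graph n)) P"
      unfolding chi_avoid_def using ex by (rule LeastI)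
    then have "3 / 4 * real n - 1 \<le> \<chi> n"
      unfolding \<chi>_def using avoiding_partition_lower_bound by blast
    moreover have "log 9 (real n) \<ge> 0"
      using n by simp
    moreover from this have "real j \<le> log 9 (real n) + 1"
      unfolding j_def by linarith
    ultimately have "\<chi> n - 3 / 4 * real n \<le> 6 * (log 9 (real n) + 1)"
      "- (\<chi> n - 3 / 4 * real n) \<le> 6 * (log 9 (real n) + 1)"
      using k(2) by argo+
    then show ?thesis
      by (rule abs_leI)
  qed
  have "(\<lambda>n. \<chi> n - 3 / 4 * real n) \<in> O(\<lambda>n. 6 * (log 9 (real n) + 1))"
  proof (rule bigoI[of _ 1])
    show "\<forall>\<^sub>F n in sequentially. norm (\<chi> n - 3 / 4 * real n) \<le> 1 * norm (6 * (log 9 (real n) + 1))"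
      using eventually_ge_at_top[of 1] by eventually_elim (use bound in force)
  qed
  also have "(\<lambda>n. 6 * (log 9 (real n) + 1)) \<in> o(\<lambda>n. real n)"
    by real_asymp
  finally show ?thesis
    by (simp add: \<chi>_def)
qed

end
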